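(* Let $R$ be a ring. Every $RD$-pure extending right $R$-module is pure extending.
   Context: Rings are associative with unity and modules are unital right modules. A submodule $P$ of a right $R$-module $M$ is pure in $M$ if for every left $R$-module $N$ the induced map $P\otimes_R N\to M\otimes_R N$ is injective. A submodule $P$ of $M$ is $RD$-pure (relatively divisible) in $M$ if $Pr=Mr\cap P$ for every $r\in R$. A submodule $N$ of $L$ is essential in $L$ if $N\cap X\neq 0$ for every nonzero submodule $X$ of $L$. An $R$-module $M$ is pure extending (respectively $RD$-pure extending) if every pure (respectively $RD$-pure) submodule of $M$ is essential in some direct summand of $M$. *)

theory Defs
  imports "HOL-Algebra.Module" "HOL-Algebra.AbelCoset" "HOL-Algebra.Generated_Groups"
    "HOL-Algebra.Free_Abelian_Groups"
begin

section \<open>Modules over arbitrary rings\<close>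

text \<open>
  The library locale for modules assumes a commutative ring. Both one-sided variants below reuse
  its record type. In a right module, \<open>r \<odot>\<^bsub>M\<^esub> x\<close> stands for the product \<open>x r\<close>,
  so that \<open>(x a) b = x (a b)\<close> becomes the associativity law with \<open>a\<close> and \<open>b\<close> swapped.
  The library predicate \<open>submodule\<close> makes no reference to commutativity or sides and is used
  unchanged.
\<close>

locale left_module = R?: ring R + M?: abelian_group M
  for R :: "('r, 'x) ring_scheme" (structure) and M :: "('r, 'm, 'y) module_scheme" (structure) +
  assumes smult_closed:
      "\<lbrakk> a \<in> carrier R; x \<in> carrier M \<rbrakk> \<Longrightarrow> a \<odot>\<^bsub>M\<^esub> x \<in> carrier M"
    and smult_l_distr:
      "\<lbrakk> a \<in> carrier R; b \<in> carrier R; x \<in> carrier M \<rbrakk> \<Longrightarrow>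
       (a \<oplus> b) \<odot>\<^bsub>M\<^esub> x = a \<odot>\<^bsub>M\<^esub> x \<oplus>\<^bsub>M\<^esub> b \<odot>\<^bsub>M\<^esub> x"
    and smult_r_distr:
      "\<lbrakk> a \<in> carrier R; x \<in> carrier M; y \<in> carrier M \<rbrakk> \<Longrightarrow>
       a \<odot>\<^bsub>M\<^esub> (x \<oplus>\<^bsub>M\<^esub> y) = a \<odot>\<^bsub>M\<^esub> x \<oplus>\<^bsub>M\<^esub> a \<odot>\<^bsub>M\<^esub> y"
    and smult_assoc:
      "\<lbrakk> a \<in> carrier R; b \<in> carrier R; x \<in> carrier M \<rbrakk> \<Longrightarrow>
       (a \<otimes> b) \<odot>\<^bsub>M\<^esub> x = a \<odot>\<^bsub>M\<^esub> (b \<odot>\<^bsub>M\<^esub> x)"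
    and smult_one:
      "x \<in> carrier M \<Longrightarrow> \<one> \<odot>\<^bsub>M\<^esub> x = x"

locale right_module = R?: ring R + M?: abelian_group M
  for R :: "('r, 'x) ring_scheme" (structure) and M :: "('r, 'm, 'y) module_scheme" (structure) +
  assumes smult_closed:
      "\<lbrakk> a \<in> carrier R; x \<in> carrier M \<rbrakk> \<Longrightarrow> a \<odot>\<^bsub>M\<^esub> x \<in> carrier M"
    and smult_l_distr:
      "\<lbrakk> a \<in> carrier R; b \<in> carrier R; x \<in> carrier M \<rbrakk> \<Longrightarrow>
       (a \<oplus> b) \<odot>\<^bsub>M\<^esub> x = a \<odot>\<^bsub>M\<^esub> x \<oplus>\<^bsub>M\<^esub> b \<odot>\<^bsub>M\<^esub> x"
    and smult_r_distr:
      "\<lbrakk> a \<in> carrier R; x \<in> carrier M; y \<in> carrier M \<rbrakk> \<Longrightarrow>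
       a \<odot>\<^bsub>M\<^esub> (x \<oplus>\<^bsub>M\<^esub> y) = a \<odot>\<^bsub>M\<^esub> x \<oplus>\<^bsub>M\<^esub> a \<odot>\<^bsub>M\<^esub> y"
    and smult_assoc:
      "\<lbrakk> a \<in> carrier R; b \<in> carrier R; x \<in> carrier M \<rbrakk> \<Longrightarrow>
       (a \<otimes> b) \<odot>\<^bsub>M\<^esub> x = b \<odot>\<^bsub>M\<^esub> (a \<odot>\<^bsub>M\<^esub> x)"
    and smult_one:
      "x \<in> carrier M \<Longrightarrow> \<one> \<odot>\<^bsub>M\<^esub> x = x"


section \<open>Tensor products\<close>

definition tensor_rels ::
  "('r, 'x) ring_scheme \<Rightarrow> ('r, 'm, 'y) module_scheme \<Rightarrow> ('r, 'n, 'z) module_scheme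
    \<Rightarrow> (('m \<times> 'n) \<Rightarrow>\<^sub>0 int) set" where
  "tensor_rels R M N =
     {frag_of (x \<oplus>\<^bsub>M\<^esub> x', y) - frag_of (x, y) - frag_of (x', y) | x x' y.
        x \<in> carrier M \<and> x' \<in> carrier M \<and> y \<in> carrier N}
   \<union> {frag_of (x, y \<oplus>\<^bsub>N\<^esub> y') - frag_of (x, y) - frag_of (x, y') | x y y'.
        x \<in> carrier M \<and> y \<in> carrier N \<and> y' \<in> carrier N}
   \<union> {frag_of (r \<odot>\<^bsub>M\<^esub> x, y) - frag_of (x, r \<odot>\<^bsub>N\<^esub> y) | r x y.
        r \<in> carrier R \<and> x \<in> carrier M \<and> y \<in> carrier N}"

definition tensor_kernel ::
  "('r, 'x) ring_scheme \<Rightarrow> ('r, 'm, 'y) module_scheme \<Rightarrow> ('r, 'n, 'z) module_scheme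
    \<Rightarrow> (('m \<times> 'n) \<Rightarrow>\<^sub>0 int) set" where
  "tensor_kernel R M N =
     generate (free_Abelian_group (carrier M \<times> carrier N)) (tensor_rels R M N)"

text \<open>The abelian group \<open>M \<otimes>\<^sub>R N\<close> of a right module \<open>M\<close> and a left module \<open>N\<close>.\<close>

definition tensor_product ::
  "('r, 'x) ring_scheme \<Rightarrow> ('r, 'm, 'y) module_scheme \<Rightarrow> ('r, 'n, 'z) module_scheme
    \<Rightarrow> (('m \<times> 'n) \<Rightarrow>\<^sub>0 int) set monoid" where
  "tensor_product R M N =
     free_Abelian_group (carrier M \<times> carrier N) Mod tensor_kernel R M N"

definition tensor ::
  "('r, 'x) ring_scheme \<Rightarrow> ('r, 'm, 'y) module_scheme \<Rightarrow> ('r, 'n, 'z) module_scheme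
    \<Rightarrow> 'm \<Rightarrow> 'n \<Rightarrow> (('m \<times> 'n) \<Rightarrow>\<^sub>0 int) set" where
  "tensor R M N x y =
     tensor_kernel R M N #>\<^bsub>free_Abelian_group (carrier M \<times> carrier N)\<^esub> frag_of (x, y)"

text \<open>
  The map \<open>P \<otimes>\<^sub>R N \<rightarrow> M \<otimes>\<^sub>R N\<close> induced by the inclusion of a submodule \<open>P\<close> of \<open>M\<close>: a coset of the
  kernel for \<open>P\<close> is sent to the coset of the (larger) kernel for \<open>M\<close> containing it.
\<close>

definition tensor_incl ::
  "('r, 'x) ring_scheme \<Rightarrow> ('r, 'm, 'y) module_scheme \<Rightarrow> ('r, 'n, 'z) module_scheme
    \<Rightarrow> (('m \<times> 'n) \<Rightarrow>\<^sub>0 int) set \<Rightarrow> (('m \<times> 'n) \<Rightarrow>\<^sub>0 int) set" where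
  "tensor_incl R M N C =
     tensor_kernel R M N <#>\<^bsub>free_Abelian_group (carrier M \<times> carrier N)\<^esub> C"


section \<open>Purity and extending modules\<close>

text \<open>
  A definition cannot quantify over the left modules of all types, so the test modules have their
  carriers in \<open>'r list\<close>. This is no restriction: every finitely generated left module has an
  isomorphic copy there, and theorem \<open>pure_submodule_injective\<close> below shows that injectivity
  then holds for left modules of every type.
\<close>

definition pure_submodule ::
  "('r, 'x) ring_scheme \<Rightarrow> ('r, 'm, 'y) module_scheme \<Rightarrow> 'm set \<Rightarrow> bool" where
  "pure_submodule R M P \<longleftrightarrow>
     submodule P R M \<and>
     (\<forall>N :: ('r, 'r list) module. left_module R N \<longrightarrow>
        inj_on (tensor_incl R M N) (carrier (tensor_product R (M\<lparr>carrier := P\<rparr>) N)))"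

definition rd_pure_submodule ::
  "('r, 'x) ring_scheme \<Rightarrow> ('r, 'm, 'y) module_scheme \<Rightarrow> 'm set \<Rightarrow> bool" where
  "rd_pure_submodule R M P \<longleftrightarrow>
     submodule P R M \<and>
     (\<forall>r \<in> carrier R. (\<lambda>x. r \<odot>\<^bsub>M\<^esub> x) ` P = (\<lambda>x. r \<odot>\<^bsub>M\<^esub> x) ` carrier M \<inter> P)"

definition essential_submodule ::
  "('r, 'x) ring_scheme \<Rightarrow> ('r, 'm, 'y) module_scheme \<Rightarrow> 'm set \<Rightarrow> bool" where
  "essential_submodule R L N \<longleftrightarrow>
     submodule N R L \<and>
     (\<forall>X. submodule X R L \<and> X \<noteq> {\<zero>\<^bsub>L\<^esub>} \<longrightarrow> N \<inter> X \<noteq> {\<zero>\<^bsub>L\<^esub>})"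

definition direct_summand ::
  "('r, 'x) ring_scheme \<Rightarrow> ('r, 'm, 'y) module_scheme \<Rightarrow> 'm set \<Rightarrow> bool" where
  "direct_summand R M D \<longleftrightarrow>
     submodule D R M \<and>
     (\<exists>D'. submodule D' R M \<and> D \<inter> D' = {\<zero>\<^bsub>M\<^esub>} \<and> D <+>\<^bsub>M\<^esub> D' = carrier M)"

definition pure_extending ::
  "('r, 'x) ring_scheme \<Rightarrow> ('r, 'm, 'y) module_scheme \<Rightarrow> bool" where
  "pure_extending R M \<longleftrightarrow>
     (\<forall>P. pure_submodule R M P \<longrightarrow>
        (\<exists>D. direct_summand R M D \<and> essential_submodule R (M\<lparr>carrier := D\<rparr>) P))"

definition rd_pure_extending ::
  "('r, 'x) ring_scheme \<Rightarrow> ('r, 'm, 'y) module_scheme \<Rightarrow> bool" where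
  "rd_pure_extending R M \<longleftrightarrow>
     (\<forall>P. rd_pure_submodule R M P \<longrightarrow>
        (\<exists>D. direct_summand R M D \<and> essential_submodule R (M\<lparr>carrier := D\<rparr>) P))"


section \<open>Adequacy of the induced map and of the test modules\<close>

lemma keys_diff_subset:
  "Poly_Mapping.keys a \<subseteq> S \<Longrightarrow> Poly_Mapping.keys b \<subseteq> S \<Longrightarrow> Poly_Mapping.keys (a - b) \<subseteq> S"
  for a b :: "'a \<Rightarrow>\<^sub>0 int"
  using keys_diff[of a b] by blast

lemma tensor_rels_cases:
  assumes "u \<in> tensor_rels R M N"
  obtains
    (add_left) x x' y where "x \<in> carrier M" "x' \<in> carrier M" "y \<in> carrier N"
      "u = frag_of (x \<oplus>\<^bsub>M\<^esub> x', y) - frag_of (x, y) - frag_of (x', y)"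
  | (add_right) x y y' where "x \<in> carrier M" "y \<in> carrier N" "y' \<in> carrier N"
      "u = frag_of (x, y \<oplus>\<^bsub>N\<^esub> y') - frag_of (x, y) - frag_of (x, y')"
  | (balance) r x y where "r \<in> carrier R" "x \<in> carrier M" "y \<in> carrier N"
      "u = frag_of (r \<odot>\<^bsub>M\<^esub> x, y) - frag_of (x, r \<odot>\<^bsub>N\<^esub> y)"
  using assms unfolding tensor_rels_def
  by (elim UnE CollectE exE conjE) (rule that; assumption)+

lemma tensor_rels_intros:
  "\<lbrakk> x \<in> carrier M; x' \<in> carrier M; y \<in> carrier N \<rbrakk> \<Longrightarrow>
     frag_of (x \<oplus>\<^bsub>M\<^esub> x', y) - frag_of (x, y) - frag_of (x', y) \<in> tensor_rels R M N"
  "\<lbrakk> x \<in> carrier M; y \<in> carrier N; y' \<in> carrier N \<rbrakk> \<Longrightarrow>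
     frag_of (x, y \<oplus>\<^bsub>N\<^esub> y') - frag_of (x, y) - frag_of (x, y') \<in> tensor_rels R M N"
  "\<lbrakk> r \<in> carrier R; x \<in> carrier M; y \<in> carrier N \<rbrakk> \<Longrightarrow>
     frag_of (r \<odot>\<^bsub>M\<^esub> x, y) - frag_of (x, r \<odot>\<^bsub>N\<^esub> y) \<in> tensor_rels R M N"
  unfolding tensor_rels_def by blast+

lemma tensor_rels_carrier:
  assumes "right_module R M" "left_module R N"
  shows "tensor_rels R M N \<subseteq> carrier (free_Abelian_group (carrier M \<times> carrier N))"
proof -
  interpret M: right_module R M by fact
  interpret N: left_module R N by fact
  show ?thesis
  proof
    fix u assume "u \<in> tensor_rels R M N"
    then show "u \<in> carrier (free_Abelian_group (carrier M \<times> carrier N))"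
      unfolding carrier_free_Abelian_group_iff
      by (cases rule: tensor_rels_cases) (simp_all add: keys_diff_subset keys_frag_of M.smult_closed N.smult_closed)
  qed
qed

lemma tensor_kernel_subgroup:
  assumes "right_module R M" "left_module R N"
  shows "subgroup (tensor_kernel R M N) (free_Abelian_group (carrier M \<times> carrier N))"
  unfolding tensor_kernel_def
  by (rule group.generate_is_subgroup[OF group_free_Abelian_group tensor_rels_carrier[OF assms]])

lemma tensor_kernel_zero: "0 \<in> tensor_kernel R M N"
  unfolding tensor_kernel_def
  using generate.one[of "free_Abelian_group (carrier M \<times> carrier N)"] by simp

lemma tensor_kernel_incl: "u \<in> tensor_rels R M N \<Longrightarrow> u \<in> tensor_kernel R M N"
  unfolding tensor_kernel_def by (rule generate.incl)

lemma tensor_kernel_add: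
  "a \<in> tensor_kernel R M N \<Longrightarrow> b \<in> tensor_kernel R M N \<Longrightarrow> a + b \<in> tensor_kernel R M N"
  unfolding tensor_kernel_def
  using generate.eng[of a "free_Abelian_group (carrier M \<times> carrier N)"] by simp

lemma tensor_kernel_minus:
  assumes "right_module R M" "left_module R N" "a \<in> tensor_kernel R M N"
  shows "- a \<in> tensor_kernel R M N"
  using subgroup.m_inv_closed[OF tensor_kernel_subgroup[OF assms(1,2)] assms(3)]
    subgroup.mem_carrier[OF tensor_kernel_subgroup[OF assms(1,2)] assms(3)]
  by simp

lemma tensor_kernel_induct [consumes 3, case_names zero rel minus_rel add]:
  assumes "z \<in> tensor_kernel R M N" "right_module R M" "left_module R N"
    and "Q 0" "\<And>h. h \<in> tensor_rels R M N \<Longrightarrow> Q h" "\<And>h. h \<in> tensor_rels R M N \<Longrightarrow> Q (- h)"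
    and "\<And>a b. Q a \<Longrightarrow> Q b \<Longrightarrow> Q (a + b)"
  shows "Q z"
  using assms(1) unfolding tensor_kernel_def
proof (induction rule: generate.induct)
  case (inv h)
  then show ?case
    using assms(6) tensor_rels_carrier[OF assms(2,3)] by auto
qed (use assms in auto)

lemma tensor_kernel_mono:
  assumes "tensor_rels R M N \<subseteq> tensor_rels R M' N'" "right_module R M" "left_module R N"
    "right_module R M'" "left_module R N'"
  shows "tensor_kernel R M N \<subseteq> tensor_kernel R M' N'"
proof
  fix z assume "z \<in> tensor_kernel R M N"
  from this assms(2,3) show "z \<in> tensor_kernel R M' N'"
  proof (induction rule: tensor_kernel_induct)
    case (rel h)
    then show ?case
      using assms(1) unfolding tensor_kernel_def by (auto intro: generate.incl)
  next
    case (minus_rel h)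
    then have "h \<in> tensor_kernel R M' N'"
      using assms(1) unfolding tensor_kernel_def by (auto intro: generate.incl)
    then show ?case using tensor_kernel_minus assms by blast
  qed (auto intro: tensor_kernel_zero tensor_kernel_add)
qed

lemma submodule_abelian_group:
  assumes "abelian_group M" "submodule P R M"
  shows "abelian_group (M\<lparr>carrier := P\<rparr>)"
proof -
  interpret abelian_group M by fact
  have s: "subgroup P (add_monoid M)" using assms(2) by (simp add: submodule_def)
  have sub: "x \<in> carrier M" if "x \<in> P" for x using subgroup.subset[OF s] that by auto
  show ?thesis
  proof (rule abelian_groupI)
    fix x assume "x \<in> carrier (M\<lparr>carrier := P\<rparr>)"
    then show "\<exists>y\<in>carrier (M\<lparr>carrier := P\<rparr>). y \<oplus>\<^bsub>M\<lparr>carrier := P\<rparr>\<^esub> x = \<zero>\<^bsub>M\<lparr>carrier := P\<rparr>\<^esub>"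
      using subgroup.m_inv_closed[OF s, of x] sub
      by (intro bexI[of _ "\<ominus>\<^bsub>M\<^esub> x"]) (auto simp: a_inv_def[symmetric] l_neg)
  qed (use subgroup.m_closed[OF s] subgroup.one_closed[OF s] in
      \<open>auto simp: a_ac sub\<close>)
qed

lemma submodule_smult:
  "submodule P R M \<Longrightarrow> a \<in> carrier R \<Longrightarrow> x \<in> P \<Longrightarrow> a \<odot>\<^bsub>M\<^esub> x \<in> P"
  by (simp add: submodule_def submodule_axioms_def)

lemma submodule_subset: "submodule P R M \<Longrightarrow> P \<subseteq> carrier M"
  using subgroup.subset by (fastforce simp: submodule_def)

lemma submodule_add: "submodule P R M \<Longrightarrow> x \<in> P \<Longrightarrow> y \<in> P \<Longrightarrow> x \<oplus>\<^bsub>M\<^esub> y \<in> P"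
  using subgroup.m_closed[of P "add_monoid M" x y] by (simp add: submodule_def)

lemma right_module_submodule:
  assumes "right_module R M" "submodule P R M"
  shows "right_module R (M\<lparr>carrier := P\<rparr>)"
proof -
  interpret M: right_module R M by fact
  note sub = submodule_subset[OF assms(2)]
  show ?thesis
    by (intro right_module.intro right_module_axioms.intro submodule_abelian_group[OF _ assms(2)]
        M.R.ring_axioms M.M.abelian_group_axioms)
      (use sub in \<open>simp_all add: subset_iff submodule_smult[OF assms(2)] M.smult_l_distr
         M.smult_r_distr M.smult_assoc M.smult_one\<close>)
qed

lemma left_module_submodule:
  assumes "left_module R M" "submodule P R M"
  shows "left_module R (M\<lparr>carrier := P\<rparr>)"
proof -
  interpret M: left_module R M by fact
  note sub = submodule_subset[OF assms(2)]
  show ?thesis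
    by (intro left_module.intro left_module_axioms.intro submodule_abelian_group[OF _ assms(2)]
        M.R.ring_axioms M.M.abelian_group_axioms)
      (use sub in \<open>simp_all add: subset_iff submodule_smult[OF assms(2)] M.smult_l_distr
         M.smult_r_distr M.smult_assoc M.smult_one\<close>)
qed

lemma tensor_kernel_submodule:
  assumes "right_module R M" "left_module R N" "submodule P R M"
  shows "tensor_kernel R (M\<lparr>carrier := P\<rparr>) N \<subseteq> tensor_kernel R M N"
proof (rule tensor_kernel_mono)
  show "tensor_rels R (M\<lparr>carrier := P\<rparr>) N \<subseteq> tensor_rels R M N"
  proof
    have sub: "x \<in> carrier M" if "x \<in> P" for x using submodule_subset[OF assms(3)] that by auto
    fix u assume "u \<in> tensor_rels R (M\<lparr>carrier := P\<rparr>) N"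
    then show "u \<in> tensor_rels R M N"
    proof (cases rule: tensor_rels_cases)
      case (add_left x x' y)
      then show ?thesis by (simp add: sub tensor_rels_intros(1))
    next
      case (add_right x y y')
      then show ?thesis by (simp add: sub tensor_rels_intros(2))
    next
      case (balance r x y)
      then show ?thesis by (simp add: sub tensor_rels_intros(3))
    qed
  qed
qed (use assms right_module_submodule in auto)

lemma free_r_coset: "K #>\<^bsub>free_Abelian_group S\<^esub> z = (\<lambda>k. k + z) ` K"
  by (auto simp: r_coset_def)

lemma tensor_incl_coset:
  assumes "right_module R M" "left_module R N" "submodule P R M"
  shows "tensor_incl R M N (tensor_kernel R (M\<lparr>carrier := P\<rparr>) N #>\<^bsub>free_Abelian_group (P \<times> carrier N)\<^esub> z)
       = tensor_kernel R M N #>\<^bsub>free_Abelian_group (carrier M \<times> carrier N)\<^esub> z"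
proof -
  let ?K = "tensor_kernel R M N" and ?L = "tensor_kernel R (M\<lparr>carrier := P\<rparr>) N"
  have "a + (l + z) \<in> (\<lambda>k. k + z) ` ?K" if "a \<in> ?K" "l \<in> ?L" for a l
    using tensor_kernel_add[OF that(1), of l] tensor_kernel_submodule[OF assms] that
    by (auto simp: add.assoc[symmetric])
  moreover have "\<exists>l\<in>?L. a + z = a + (l + z)" for a
    using tensor_kernel_zero by force
  ultimately show ?thesis
    unfolding tensor_incl_def free_r_coset set_mult_def by auto
qed

lemma tensor_incl_tensor:
  assumes "right_module R M" "left_module R N" "submodule P R M"
  shows "tensor_incl R M N (tensor R (M\<lparr>carrier := P\<rparr>) N x y) = tensor R M N x y"
  using tensor_incl_coset[OF assms] by (simp add: tensor_def)

lemma tensor_kernel_normal: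
  assumes "right_module R M" "left_module R N"
  shows "tensor_kernel R M N \<lhd> free_Abelian_group (carrier M \<times> carrier N)"
  using comm_group.normal_iff_subgroup[OF abelian_free_Abelian_group]
    tensor_kernel_subgroup[OF assms] by blast

lemma carrier_tensor_product:
  "carrier (tensor_product R M N) =
     (\<lambda>z. tensor_kernel R M N #>\<^bsub>free_Abelian_group (carrier M \<times> carrier N)\<^esub> z)
       ` carrier (free_Abelian_group (carrier M \<times> carrier N))"
  by (auto simp: tensor_product_def FactGroup_def RCOSETS_def)

lemma tensor_product_mult:
  assumes "right_module R M" "left_module R N"
    and "a \<in> carrier (free_Abelian_group (carrier M \<times> carrier N))"
    and "b \<in> carrier (free_Abelian_group (carrier M \<times> carrier N))"
  shows "(tensor_kernel R M N #>\<^bsub>free_Abelian_group (carrier M \<times> carrier N)\<^esub> a)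
      \<otimes>\<^bsub>tensor_product R M N\<^esub>
      (tensor_kernel R M N #>\<^bsub>free_Abelian_group (carrier M \<times> carrier N)\<^esub> b)
    = tensor_kernel R M N #>\<^bsub>free_Abelian_group (carrier M \<times> carrier N)\<^esub> (a + b)"
  using normal.rcos_sum[OF tensor_kernel_normal[OF assms(1,2)] assms(3,4)]
  by (simp only: tensor_product_def FactGroup_def monoid.simps mult_free_Abelian_group)

lemma tensor_incl_hom:
  assumes "right_module R M" "left_module R N" "submodule P R M"
  shows "tensor_incl R M N \<in> hom (tensor_product R (M\<lparr>carrier := P\<rparr>) N) (tensor_product R M N)"
proof (rule homI)
  let ?P = "M\<lparr>carrier := P\<rparr>"
  let ?FP = "free_Abelian_group (carrier ?P \<times> carrier N)"
  let ?FM = "free_Abelian_group (carrier M \<times> carrier N)"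
  have incl: "tensor_incl R M N (tensor_kernel R ?P N #>\<^bsub>?FP\<^esub> z) = tensor_kernel R M N #>\<^bsub>?FM\<^esub> z" for z
    using tensor_incl_coset[OF assms, of z] by simp
  have sub: "z \<in> carrier ?FM" if "z \<in> carrier ?FP" for z
  proof -
    have "Poly_Mapping.keys z \<subseteq> P \<times> carrier N" using that by simp
    also have "\<dots> \<subseteq> carrier M \<times> carrier N" using submodule_subset[OF assms(3)] by auto
    finally show ?thesis by simp
  qed
  have ex: "\<exists>a \<in> carrier ?FP. A = tensor_kernel R ?P N #>\<^bsub>?FP\<^esub> a"
    if "A \<in> carrier (tensor_product R ?P N)" for A
    using that unfolding carrier_tensor_product image_iff .
  fix A B assume A: "A \<in> carrier (tensor_product R ?P N)"
  obtain a where a: "a \<in> carrier ?FP" "A = tensor_kernel R ?P N #>\<^bsub>?FP\<^esub> a"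
    using ex[OF A] by blast
  show "tensor_incl R M N A \<in> carrier (tensor_product R M N)"
    unfolding a(2) incl carrier_tensor_product by (rule imageI[OF sub[OF a(1)]])
  assume B: "B \<in> carrier (tensor_product R ?P N)"
  obtain b where b: "b \<in> carrier ?FP" "B = tensor_kernel R ?P N #>\<^bsub>?FP\<^esub> b"
    using ex[OF B] by blast
  show "tensor_incl R M N (A \<otimes>\<^bsub>tensor_product R ?P N\<^esub> B)
      = tensor_incl R M N A \<otimes>\<^bsub>tensor_product R M N\<^esub> tensor_incl R M N B"
    unfolding a(2) b(2) incl tensor_product_mult[OF assms(1,2) sub[OF a(1)] sub[OF b(1)]]
      tensor_product_mult[OF right_module_submodule[OF assms(1,3)] assms(2) a(1) b(1)] ..
qed

lemma tensor_coset_eq_iff: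
  assumes "right_module R M" "left_module R N"
  shows "tensor_kernel R M N #>\<^bsub>free_Abelian_group S\<^esub> a =
         tensor_kernel R M N #>\<^bsub>free_Abelian_group S\<^esub> b \<longleftrightarrow> a - b \<in> tensor_kernel R M N"
  (is "?l \<longleftrightarrow> ?r")
proof
  assume ?l
  moreover have "a \<in> (\<lambda>k. k + a) ` tensor_kernel R M N"
    using tensor_kernel_zero[of R M N] by force
  ultimately obtain k where "k \<in> tensor_kernel R M N" "a = k + b"
    unfolding free_r_coset by auto
  then show ?r by simp
next
  assume ?r
  then have k: "k + (a - b) \<in> tensor_kernel R M N" "k - (a - b) \<in> tensor_kernel R M N"
    if "k \<in> tensor_kernel R M N" for k
    using that tensor_kernel_add[of k R M N "a - b"] tensor_kernel_add[of k R M N "- (a - b)"]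
      tensor_kernel_minus[OF assms, of "a - b"] by (simp_all add: algebra_simps)
  show ?l
    unfolding free_r_coset
  proof (intro equalityI image_subsetI)
    fix k assume "k \<in> tensor_kernel R M N"
    note k = k[OF this]
    show "k + a \<in> (\<lambda>k. k + b) ` tensor_kernel R M N"
      by (rule image_eqI[OF _ k(1)]) simp
    show "k + b \<in> (\<lambda>k. k + a) ` tensor_kernel R M N"
      by (rule image_eqI[OF _ k(2)]) simp
  qed
qed

lemma tensor_incl_inj_iff:
  assumes "right_module R M" "left_module R N" "submodule P R M"
  shows "inj_on (tensor_incl R M N) (carrier (tensor_product R (M\<lparr>carrier := P\<rparr>) N)) \<longleftrightarrow>
         (\<forall>z. Poly_Mapping.keys z \<subseteq> P \<times> carrier N \<longrightarrow> z \<in> tensor_kernel R M N \<longrightarrow>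
              z \<in> tensor_kernel R (M\<lparr>carrier := P\<rparr>) N)"
  (is "?inj \<longleftrightarrow> ?ker")
proof -
  let ?P = "M\<lparr>carrier := P\<rparr>"
  let ?FP = "free_Abelian_group (P \<times> carrier N)"
  note P = right_module_submodule[OF assms(1,3)]
  have inj: "?inj \<longleftrightarrow> (\<forall>a b. Poly_Mapping.keys a \<subseteq> P \<times> carrier N \<longrightarrow>
      Poly_Mapping.keys b \<subseteq> P \<times> carrier N \<longrightarrow>
      a - b \<in> tensor_kernel R M N \<longrightarrow> a - b \<in> tensor_kernel R ?P N)"
    unfolding inj_on_def carrier_tensor_product
    by (auto simp: tensor_incl_coset[OF assms] tensor_coset_eq_iff[OF assms(1,2)]
        tensor_coset_eq_iff[OF P assms(2)])
  show ?thesis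
  proof
    assume ?inj
    show ?ker
    proof (intro allI impI)
      fix z
      assume z: "Poly_Mapping.keys z \<subseteq> P \<times> carrier N" "z \<in> tensor_kernel R M N"
      then show "z \<in> tensor_kernel R ?P N"
        using \<open>?inj\<close>[unfolded inj, rule_format, of z 0] by simp
    qed
  next
    assume ?ker
    moreover have "Poly_Mapping.keys (a - b) \<subseteq> P \<times> carrier N"
      if "Poly_Mapping.keys a \<subseteq> P \<times> carrier N" "Poly_Mapping.keys b \<subseteq> P \<times> carrier N" for a b
      using keys_diff[of a b] that by blast
    ultimately show ?inj unfolding inj by blast
  qed
qed

lemma tensor_kernel_map:
  assumes "right_module R M" "left_module R N" "left_module R N'"
    and g: "\<And>y. y \<in> carrier N \<Longrightarrow> g y \<in> carrier N'"
      "\<And>y y'. y \<in> carrier N \<Longrightarrow> y' \<in> carrier N \<Longrightarrow> g (y \<oplus>\<^bsub>N\<^esub> y') = g y \<oplus>\<^bsub>N'\<^esub> g y'"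
      "\<And>r y. r \<in> carrier R \<Longrightarrow> y \<in> carrier N \<Longrightarrow> g (r \<odot>\<^bsub>N\<^esub> y) = r \<odot>\<^bsub>N'\<^esub> g y"
    and z: "z \<in> tensor_kernel R M N"
  shows "frag_extend (\<lambda>(x, y). frag_of (x, g y)) z \<in> tensor_kernel R M N'"
proof -
  interpret M: right_module R M by fact
  interpret N: left_module R N by fact
  let ?h = "frag_extend (\<lambda>(x, y). frag_of (x, g y))"
  have rel: "?h u \<in> tensor_rels R M N'" if "u \<in> tensor_rels R M N" for u
    using that
  proof (cases rule: tensor_rels_cases)
    case (add_left x x' y)
    then show ?thesis by (simp add: frag_extend_diff g tensor_rels_intros)
  next
    case (add_right x y y')
    then show ?thesis by (simp add: frag_extend_diff g tensor_rels_intros)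
  next
    case (balance r x y)
    then show ?thesis by (simp add: frag_extend_diff g tensor_rels_intros)
  qed
  from z assms(1,2) show ?thesis
  proof (induction rule: tensor_kernel_induct)
    case (minus_rel u)
    then show ?case
      using tensor_kernel_minus[OF assms(1,3) tensor_kernel_incl[OF rel]] by (simp add: frag_extend_minus)
  qed (auto simp: frag_extend_add intro: tensor_kernel_incl rel tensor_kernel_zero tensor_kernel_add)
qed

lemma tensor_kernel_finite:
  assumes "right_module R M" "left_module R N" "z \<in> tensor_kernel R M N"
  shows "\<exists>B. finite B \<and> B \<subseteq> carrier N \<and>
    (\<forall>N0. submodule N0 R N \<and> B \<subseteq> N0 \<longrightarrow> z \<in> tensor_kernel R M (N\<lparr>carrier := N0\<rparr>))"
proof -
  have rels: "\<exists>B. finite B \<and> B \<subseteq> carrier N \<and>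
      (\<forall>N0. submodule N0 R N \<and> B \<subseteq> N0 \<longrightarrow> u \<in> tensor_rels R M (N\<lparr>carrier := N0\<rparr>))"
    if "u \<in> tensor_rels R M N" for u
  proof -
    from that show ?thesis
    proof (cases rule: tensor_rels_cases)
      case (add_left x x' y)
      then show ?thesis
        using tensor_rels_intros(1)[of x M x' y "N\<lparr>carrier := N0\<rparr>" R for N0]
        by (intro exI[of _ "{y}"]) simp
    next
      case (add_right x y y')
      then show ?thesis
        using tensor_rels_intros(2)[of x M y "N\<lparr>carrier := N0\<rparr>" y' R for N0]
        by (intro exI[of _ "{y, y'}"]) simp
    next
      case (balance r x y)
      then show ?thesis
        using tensor_rels_intros(3)[of r R x M y "N\<lparr>carrier := N0\<rparr>" for N0]
        by (intro exI[of _ "{y}"]) simp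
    qed
  qed
  from assms(3,1,2) show ?thesis
  proof (induction rule: tensor_kernel_induct)
    case zero
    show ?case by (intro exI[of _ "{}"]) (auto intro: tensor_kernel_zero)
  next
    case (rel u)
    then obtain B where B: "finite B" "B \<subseteq> carrier N"
      "\<And>N0. submodule N0 R N \<Longrightarrow> B \<subseteq> N0 \<Longrightarrow> u \<in> tensor_rels R M (N\<lparr>carrier := N0\<rparr>)"
      using rels[of u] by auto
    then show ?case
      by (intro exI[of _ B] conjI allI impI) (auto intro: tensor_kernel_incl)
  next
    case (minus_rel u)
    then obtain B where B: "finite B" "B \<subseteq> carrier N"
      "\<And>N0. submodule N0 R N \<Longrightarrow> B \<subseteq> N0 \<Longrightarrow> u \<in> tensor_rels R M (N\<lparr>carrier := N0\<rparr>)"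
      using rels[of u] by auto
    have "- u \<in> tensor_kernel R M (N\<lparr>carrier := N0\<rparr>)" if "submodule N0 R N" "B \<subseteq> N0" for N0
      by (rule tensor_kernel_minus[OF assms(1) left_module_submodule[OF assms(2) that(1)]
            tensor_kernel_incl[OF B(3)[OF that]]])
    then show ?case using B(1,2) by blast
  next
    case (add a b)
    obtain A where A: "finite A" "A \<subseteq> carrier N"
      "\<forall>N0. submodule N0 R N \<and> A \<subseteq> N0 \<longrightarrow> a \<in> tensor_kernel R M (N\<lparr>carrier := N0\<rparr>)"
      using add(1) by (elim exE conjE)
    obtain B where B: "finite B" "B \<subseteq> carrier N"
      "\<forall>N0. submodule N0 R N \<and> B \<subseteq> N0 \<longrightarrow> b \<in> tensor_kernel R M (N\<lparr>carrier := N0\<rparr>)"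
      using add(2) by (elim exE conjE)
    have "a + b \<in> tensor_kernel R M (N\<lparr>carrier := N0\<rparr>)"
      if "submodule N0 R N" "A \<union> B \<subseteq> N0" for N0
      using A(3) B(3) that by (intro tensor_kernel_add) auto
    then show ?case
      using A(1,2) B(1,2) by (intro exI[of _ "A \<union> B"]) simp
  qed
qed

lemma finitely_generated_submodule:
  fixes R :: "('r, 'x) ring_scheme" and N :: "('r, 'n, 'z) module_scheme"
  assumes "left_module R N" "finite B" "B \<subseteq> carrier N"
  shows "\<exists>N0. submodule N0 R N \<and> B \<subseteq> N0 \<and> (\<exists>f :: 'r list \<Rightarrow> 'n. N0 \<subseteq> range f)"
  using assms(2,3)
proof (induction rule: finite_induct)
  interpret N: left_module R N by fact
  have zero: "a \<odot>\<^bsub>N\<^esub> \<zero>\<^bsub>N\<^esub> = \<zero>\<^bsub>N\<^esub>" if "a \<in> carrier R" for a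
    using N.smult_r_distr[of a "\<zero>\<^bsub>N\<^esub>" "\<zero>\<^bsub>N\<^esub>"] that N.smult_closed
    by (metis N.M.add.r_cancel_one' N.M.l_zero N.M.zero_closed)
  case empty
  have "submodule {\<zero>\<^bsub>N\<^esub>} R N"
    by (intro submodule.intro submodule_axioms.intro N.M.add.triv_subgroup) (auto simp: zero)
  then show ?case by (intro exI[of _ "{\<zero>\<^bsub>N\<^esub>}"]) auto
next
  interpret N: left_module R N by fact
  case (insert b B)
  then obtain N0 and f :: "'r list \<Rightarrow> 'n" where N0: "submodule N0 R N" "B \<subseteq> N0" "N0 \<subseteq> range f"
    by auto
  have b: "b \<in> carrier N" using insert by simp
  note sub = submodule_subset[OF N0(1)]
  have z0: "\<zero>\<^bsub>N\<^esub> \<in> N0"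
    using N0(1) subgroup.one_closed[of N0 "add_monoid N"] by (simp add: submodule_def)
  have i0: "\<ominus>\<^bsub>N\<^esub> y \<in> N0" if "y \<in> N0" for y
    using N0(1) subgroup.m_inv_closed[of N0 "add_monoid N"] that
    by (simp add: submodule_def a_inv_def)
  have lnull: "\<zero>\<^bsub>R\<^esub> \<odot>\<^bsub>N\<^esub> b = \<zero>\<^bsub>N\<^esub>"
    using N.smult_l_distr[of "\<zero>\<^bsub>R\<^esub>" "\<zero>\<^bsub>R\<^esub>" b] b N.smult_closed
    by (metis N.M.add.r_cancel_one' N.R.l_zero N.R.zero_closed)
  have neg: "\<ominus>\<^bsub>N\<^esub> (c \<odot>\<^bsub>N\<^esub> b) = (\<ominus>\<^bsub>R\<^esub> c) \<odot>\<^bsub>N\<^esub> b" if "c \<in> carrier R" for c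
    using N.smult_l_distr[of c "\<ominus>\<^bsub>R\<^esub> c" b] that b lnull
    by (metis N.M.minus_equality N.R.a_inv_closed N.R.l_neg N.smult_closed N.smult_l_distr)
  define N1 where "N1 = {c \<odot>\<^bsub>N\<^esub> b \<oplus>\<^bsub>N\<^esub> y | c y. c \<in> carrier R \<and> y \<in> N0}"
  have N1I: "v \<in> N1" if "v = c \<odot>\<^bsub>N\<^esub> b \<oplus>\<^bsub>N\<^esub> y" "c \<in> carrier R" "y \<in> N0" for v c y
    using that unfolding N1_def by blast
  have "submodule N1 R N"
  proof (intro submodule.intro submodule_axioms.intro N.M.add.subgroupI)
    show "N1 \<subseteq> carrier N" using sub b by (auto simp: N1_def intro: N.smult_closed)
    show "N1 \<noteq> {}" using z0 N1I by blast
  next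
    fix v assume "v \<in> N1"
    then obtain c y where v: "v = c \<odot>\<^bsub>N\<^esub> b \<oplus>\<^bsub>N\<^esub> y" "c \<in> carrier R" "y \<in> N0"
      unfolding N1_def by blast
    have yc: "y \<in> carrier N" using v sub by auto
    have "\<ominus>\<^bsub>N\<^esub> v = (\<ominus>\<^bsub>R\<^esub> c) \<odot>\<^bsub>N\<^esub> b \<oplus>\<^bsub>N\<^esub> \<ominus>\<^bsub>N\<^esub> y"
      using v b yc neg by (simp add: N.M.minus_add N.smult_closed)
    then show "\<ominus>\<^bsub>N\<^esub> v \<in> N1" using v i0 by (intro N1I[of _ "\<ominus>\<^bsub>R\<^esub> c" "\<ominus>\<^bsub>N\<^esub> y"]) auto
    fix a assume a: "a \<in> carrier R"
    have "a \<odot>\<^bsub>N\<^esub> v = (a \<otimes>\<^bsub>R\<^esub> c) \<odot>\<^bsub>N\<^esub> b \<oplus>\<^bsub>N\<^esub> a \<odot>\<^bsub>N\<^esub> y"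
      using v a b yc by (simp add: N.smult_r_distr N.smult_assoc N.smult_closed)
    then show "a \<odot>\<^bsub>N\<^esub> v \<in> N1"
      using v a submodule_smult[OF N0(1)] by (intro N1I[of _ "a \<otimes>\<^bsub>R\<^esub> c" "a \<odot>\<^bsub>N\<^esub> y"]) auto
  next
    fix v w assume "v \<in> N1" "w \<in> N1"
    then obtain c y d x where v: "v = c \<odot>\<^bsub>N\<^esub> b \<oplus>\<^bsub>N\<^esub> y" "c \<in> carrier R" "y \<in> N0"
      "w = d \<odot>\<^bsub>N\<^esub> b \<oplus>\<^bsub>N\<^esub> x" "d \<in> carrier R" "x \<in> N0"
      unfolding N1_def by blast
    have c: "y \<in> carrier N" "x \<in> carrier N" using v sub by auto
    have "v \<oplus>\<^bsub>N\<^esub> w = (c \<oplus>\<^bsub>R\<^esub> d) \<odot>\<^bsub>N\<^esub> b \<oplus>\<^bsub>N\<^esub> (y \<oplus>\<^bsub>N\<^esub> x)"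
      using v b c by (simp add: N.smult_l_distr N.smult_closed N.M.add.m_ac)
    then show "v \<oplus>\<^bsub>N\<^esub> w \<in> N1"
      using v submodule_add[OF N0(1)] by (intro N1I[of _ "c \<oplus>\<^bsub>R\<^esub> d" "y \<oplus>\<^bsub>N\<^esub> x"]) auto
  qed
  moreover have "insert b B \<subseteq> N1"
  proof
    fix v assume "v \<in> insert b B"
    then consider "v = b" | "v \<in> N0" using N0 by auto
    then show "v \<in> N1"
    proof cases
      case 1
      then show ?thesis using b z0 by (intro N1I[of v "\<one>\<^bsub>R\<^esub>" "\<zero>\<^bsub>N\<^esub>"]) (auto simp: N.smult_one)
    next
      case 2
      then show ?thesis using sub lnull by (intro N1I[of v "\<zero>\<^bsub>R\<^esub>" v]) auto
    qed
  qed
  moreover have "N1 \<subseteq> range (\<lambda>cs. hd cs \<odot>\<^bsub>N\<^esub> b \<oplus>\<^bsub>N\<^esub> f (tl cs))"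
  proof
    fix v assume "v \<in> N1"
    then obtain c ys where "v = c \<odot>\<^bsub>N\<^esub> b \<oplus>\<^bsub>N\<^esub> f ys" using N0(3) unfolding N1_def by blast
    then show "v \<in> range (\<lambda>cs. hd cs \<odot>\<^bsub>N\<^esub> b \<oplus>\<^bsub>N\<^esub> f (tl cs))"
      by (intro range_eqI[of _ _ "c # ys"]) simp
  qed
  ultimately show ?case by blast
qed

lemma left_module_copy:
  fixes R :: "('r, 'x) ring_scheme" and N :: "('r, 'n, 'z) module_scheme" and f :: "'e \<Rightarrow> 'n"
  assumes "left_module R N" "carrier N \<subseteq> range f"
  shows "\<exists>(N' :: ('r, 'e) module) g. left_module R N' \<and>
    (\<forall>y \<in> carrier N. g y \<in> carrier N' \<and> f (g y) = y) \<and>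
    (\<forall>u \<in> carrier N'. f u \<in> carrier N) \<and>
    (\<forall>y \<in> carrier N. \<forall>y' \<in> carrier N. g (y \<oplus>\<^bsub>N\<^esub> y') = g y \<oplus>\<^bsub>N'\<^esub> g y') \<and>
    (\<forall>r \<in> carrier R. \<forall>y \<in> carrier N. g (r \<odot>\<^bsub>N\<^esub> y) = r \<odot>\<^bsub>N'\<^esub> g y) \<and>
    (\<forall>u \<in> carrier N'. \<forall>v \<in> carrier N'. f (u \<oplus>\<^bsub>N'\<^esub> v) = f u \<oplus>\<^bsub>N\<^esub> f v) \<and>
    (\<forall>r \<in> carrier R. \<forall>u \<in> carrier N'. f (r \<odot>\<^bsub>N'\<^esub> u) = r \<odot>\<^bsub>N\<^esub> f u)"
proof -
  interpret N: left_module R N by fact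
  define g where "g = inv_into UNIV f"
  have fg: "f (g y) = y" if "y \<in> carrier N" for y
    unfolding g_def using that assms(2) by (auto intro: f_inv_into_f)
  define N' :: "('r, 'e) module" where
    "N' = \<lparr>carrier = g ` carrier N, monoid.mult = (\<lambda>u v. u), one = g \<zero>\<^bsub>N\<^esub>, ring.zero = g \<zero>\<^bsub>N\<^esub>,
           add = (\<lambda>u v. g (f u \<oplus>\<^bsub>N\<^esub> f v)), smult = (\<lambda>r u. g (r \<odot>\<^bsub>N\<^esub> f u))\<rparr>"
  have sel: "carrier N' = g ` carrier N" "\<zero>\<^bsub>N'\<^esub> = g \<zero>\<^bsub>N\<^esub>"
    "\<And>u v. u \<oplus>\<^bsub>N'\<^esub> v = g (f u \<oplus>\<^bsub>N\<^esub> f v)" "\<And>r u. r \<odot>\<^bsub>N'\<^esub> u = g (r \<odot>\<^bsub>N\<^esub> f u)"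
    by (simp_all add: N'_def)
  have "abelian_group N'"
  proof (rule abelian_groupI)
    fix u assume "u \<in> carrier N'"
    then obtain y where "y \<in> carrier N" "u = g y" by (auto simp: sel)
    then show "\<exists>v\<in>carrier N'. v \<oplus>\<^bsub>N'\<^esub> u = \<zero>\<^bsub>N'\<^esub>"
      by (intro bexI[of _ "g (\<ominus>\<^bsub>N\<^esub> y)"]) (auto simp: sel fg N.M.l_neg)
  qed (auto simp: sel fg N.M.a_ac)
  then have mod: "left_module R N'"
    by (intro left_module.intro left_module_axioms.intro N.R.ring_axioms)
      (auto simp: sel fg N.smult_closed N.smult_l_distr N.smult_r_distr N.smult_assoc N.smult_one)
  have f: "f u \<in> carrier N" if "u \<in> carrier N'" for u
    using that by (auto simp: sel fg)
  show ?thesis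
  proof (intro exI[of _ N'] exI[of _ g] conjI ballI mod)
  qed (auto simp: f sel fg N.smult_closed)
qed

theorem pure_submodule_injective:
  fixes R :: "('r, 'x) ring_scheme" and M :: "('r, 'm, 'y) module_scheme"
    and N :: "('r, 'n, 'z) module_scheme"
  assumes M: "right_module R M" and pure: "pure_submodule R M P" and N: "left_module R N"
  shows "inj_on (tensor_incl R M N) (carrier (tensor_product R (M\<lparr>carrier := P\<rparr>) N))"
proof -
  let ?P = "M\<lparr>carrier := P\<rparr>"
  have sP: "submodule P R M" using pure by (simp add: pure_submodule_def)
  note P = right_module_submodule[OF M sP]
  have "z \<in> tensor_kernel R ?P N"
    if z: "Poly_Mapping.keys z \<subseteq> P \<times> carrier N" "z \<in> tensor_kernel R M N" for z
  proof -
    obtain B where B: "finite B" "B \<subseteq> carrier N"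
      "\<And>N0. submodule N0 R N \<Longrightarrow> B \<subseteq> N0 \<Longrightarrow> z \<in> tensor_kernel R M (N\<lparr>carrier := N0\<rparr>)"
      using tensor_kernel_finite[OF M N z(2)] by blast
    have "finite (B \<union> snd ` Poly_Mapping.keys z)" "B \<union> snd ` Poly_Mapping.keys z \<subseteq> carrier N"
      using B z(1) by auto
    then obtain N0 and f :: "'r list \<Rightarrow> 'n" where N0: "submodule N0 R N" "B \<subseteq> N0"
      "snd ` Poly_Mapping.keys z \<subseteq> N0" "N0 \<subseteq> range f"
      using finitely_generated_submodule[OF N] by (metis le_sup_iff)
    note mN0 = left_module_submodule[OF N N0(1)]
    obtain N' :: "('r, 'r list) module" and g where N': "left_module R N'"
      "\<forall>y \<in> N0. g y \<in> carrier N' \<and> f (g y) = y"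
      "\<forall>u \<in> carrier N'. f u \<in> N0"
      "\<forall>y \<in> N0. \<forall>y' \<in> N0. g (y \<oplus>\<^bsub>N\<^esub> y') = g y \<oplus>\<^bsub>N'\<^esub> g y'"
      "\<forall>r \<in> carrier R. \<forall>y \<in> N0. g (r \<odot>\<^bsub>N\<^esub> y) = r \<odot>\<^bsub>N'\<^esub> g y"
      "\<forall>u \<in> carrier N'. \<forall>v \<in> carrier N'. f (u \<oplus>\<^bsub>N'\<^esub> v) = f u \<oplus>\<^bsub>N\<^esub> f v"
      "\<forall>r \<in> carrier R. \<forall>u \<in> carrier N'. f (r \<odot>\<^bsub>N'\<^esub> u) = r \<odot>\<^bsub>N\<^esub> f u"
      using left_module_copy[OF mN0, of f] N0(4)
      by (simp, elim exE conjE) (rule that; assumption)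
    define w where "w = frag_extend (\<lambda>(x, y). frag_of (x, g y)) z"
    have "w \<in> tensor_kernel R M N'"
      unfolding w_def
      by (rule tensor_kernel_map[OF M mN0 N'(1) _ _ _ B(3)[OF N0(1,2)]]) (use N' in auto)
    moreover have "Poly_Mapping.keys w \<subseteq> P \<times> carrier N'"
    proof -
      have "Poly_Mapping.keys w \<subseteq>
          (\<Union>p \<in> Poly_Mapping.keys z. Poly_Mapping.keys (case p of (x, y) \<Rightarrow> frag_of (x, g y)))"
        unfolding w_def by (rule keys_frag_extend)
      also have "\<dots> \<subseteq> P \<times> carrier N'"
        using z(1) N0(3) N'(2) by (fastforce simp: keys_frag_of split: prod.splits)
      finally show ?thesis .
    qed
    moreover have "inj_on (tensor_incl R M N') (carrier (tensor_product R ?P N'))"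
      using pure N'(1) by (simp add: pure_submodule_def)
    ultimately have "w \<in> tensor_kernel R ?P N'"
      using tensor_incl_inj_iff[OF M N'(1) sP] by blast
    then have "frag_extend (\<lambda>(x, y). frag_of (x, f y)) w \<in> tensor_kernel R ?P N"
      by (rule tensor_kernel_map[OF P N'(1) N, rotated 3])
        (use N' submodule_subset[OF N0(1)] in auto)
    moreover have "frag_extend (\<lambda>(x, y). frag_of (x, f y)) w = z"
    proof -
      let ?F = "\<lambda>(x, y). frag_of (x, f y)" and ?G = "\<lambda>(x, y). (x, g y)"
      have G: "(\<lambda>(x, y). frag_of (x, g y)) = frag_of \<circ> ?G" by auto
      have "frag_extend ?F w = frag_extend (?F \<circ> ?G) z"
        unfolding w_def G by (rule frag_extend_compose)
      also have "\<dots> = frag_extend frag_of z"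
      proof (rule frag_extend_eq)
        fix p assume "p \<in> Poly_Mapping.keys z"
        then have "snd p \<in> N0" using N0(3) by auto
        then show "(?F \<circ> ?G) p = frag_of p" using N'(2) by (cases p) simp
      qed
      also have "\<dots> = z" by (rule frag_expansion[symmetric])
      finally show ?thesis .
    qed
    ultimately show ?thesis by simp
  qed
  then show ?thesis using tensor_incl_inj_iff[OF M N sP] by blast
qed

end

theory Submission
  imports Defs
begin

text \<open>
  It suffices that pure submodules are \<open>RD\<close>-pure. If \<open>m r \<in> P\<close>, then in \<open>M \<otimes> R/Rr\<close> the element
  \<open>m r \<otimes> 1 = m \<otimes> r\<close> vanishes; by purity it vanishes already in \<open>P \<otimes> R/Rr\<close>, which maps to \<open>P/Pr\<close>
  by \<open>p \<otimes> s \<mapsto> p s\<close>, whence \<open>m r \<in> P r\<close>.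
\<close>

section \<open>The left module R/I of a left ideal I\<close>

text \<open>The choice depends on x only through the set I + x, so congruent elements get literally
  the same representative and congruence modulo I becomes equality.\<close>

definition coset_rep :: "('r, 'x) ring_scheme \<Rightarrow> 'r set \<Rightarrow> 'r \<Rightarrow> 'r" where
  "coset_rep R I x = (SOME y. y \<in> I +>\<^bsub>R\<^esub> x)"

text \<open>\<open>R/I\<close> is realised on a system of coset representatives; its elements then act on right modules.\<close>

definition left_quotient :: "('r, 'x) ring_scheme \<Rightarrow> 'r set \<Rightarrow> ('r, 'r) module" where
  "left_quotient R I =
     \<lparr>carrier = coset_rep R I ` carrier R, monoid.mult = (\<lambda>x y. x), one = coset_rep R I \<zero>\<^bsub>R\<^esub>,
      ring.zero = coset_rep R I \<zero>\<^bsub>R\<^esub>, add = (\<lambda>x y. coset_rep R I (x \<oplus>\<^bsub>R\<^esub> y)),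
      smult = (\<lambda>a x. coset_rep R I (a \<otimes>\<^bsub>R\<^esub> x))\<rparr>"

lemma left_quotient_simps [simp]:
  "carrier (left_quotient R I) = coset_rep R I ` carrier R"
  "\<zero>\<^bsub>left_quotient R I\<^esub> = coset_rep R I \<zero>\<^bsub>R\<^esub>"
  "x \<oplus>\<^bsub>left_quotient R I\<^esub> y = coset_rep R I (x \<oplus>\<^bsub>R\<^esub> y)"
  "a \<odot>\<^bsub>left_quotient R I\<^esub> x = coset_rep R I (a \<otimes>\<^bsub>R\<^esub> x)"
  by (simp_all add: left_quotient_def)

text \<open>Closure is one-sided on purpose: the ideals Rr to be factored out are in general not
  two-sided, and R/I is wanted as a left module.\<close>

locale left_ideal = ring R + additive_subgroup I R
  for I and R :: "('r, 'x) ring_scheme" (structure) +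
  assumes l_mult_closed: "\<lbrakk> a \<in> carrier R; i \<in> I \<rbrakk> \<Longrightarrow> a \<otimes> i \<in> I"
begin

sublocale abelian_subgroup I R
  by (rule abelian_subgroupI3) unfold_locales

lemma coset_rep_eq_add:
  assumes "x \<in> carrier R"
  obtains i where "i \<in> I" "coset_rep R I x = i \<oplus> x"
proof -
  have "coset_rep R I x \<in> I +> x"
    unfolding coset_rep_def by (rule someI[of _ x]) (rule a_rcos_self[OF assms])
  then show thesis using that by (auto simp: a_r_coset_def')
qed

lemma coset_rep_closed [simp]: "x \<in> carrier R \<Longrightarrow> coset_rep R I x \<in> carrier R"
  using coset_rep_eq_add[of x] by (metis a_Hcarr add.m_closed)

text \<open>Both arguments lie in the same coset of I, so \<open>SOME\<close> chooses from the same
  set on either side.\<close>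

lemma coset_rep_add_left:
  assumes "x \<in> carrier R" "i \<in> I"
  shows "coset_rep R I (i \<oplus> x) = coset_rep R I x"
proof -
  have "i \<oplus> x \<in> I +> x" using assms by (auto simp: a_r_coset_def')
  from a_repr_independence'[OF this assms(1)] show ?thesis
    by (simp add: coset_rep_def)
qed

text \<open>A representative differs from x by a summand in I, which the outer
  \<open>coset_rep\<close> absorbs. As rewrite rules these equations erase inner
  representatives.\<close>

lemma coset_rep_add_coset_rep:
  assumes "x \<in> carrier R" "y \<in> carrier R"
  shows "coset_rep R I (coset_rep R I x \<oplus> y) = coset_rep R I (x \<oplus> y)"
    and "coset_rep R I (y \<oplus> coset_rep R I x) = coset_rep R I (y \<oplus> x)"
proof -
  obtain i where i: "i \<in> I" "coset_rep R I x = i \<oplus> x" using coset_rep_eq_add[OF assms(1)] .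
  show *: "coset_rep R I (coset_rep R I x \<oplus> y) = coset_rep R I (x \<oplus> y)"
    using coset_rep_add_left[of "x \<oplus> y" i] i assms by (simp add: a_assoc)
  then show "coset_rep R I (y \<oplus> coset_rep R I x) = coset_rep R I (y \<oplus> x)"
    using assms by (simp add: a_comm)
qed

text \<open>With representative i + x the product is a i + a x, and a i stays in I. This is where
  closure under left multiplication enters.\<close>

lemma coset_rep_mult_coset_rep:
  assumes "x \<in> carrier R" "a \<in> carrier R"
  shows "coset_rep R I (a \<otimes> coset_rep R I x) = coset_rep R I (a \<otimes> x)"
proof -
  obtain i where i: "i \<in> I" "coset_rep R I x = i \<oplus> x" using coset_rep_eq_add[OF assms(1)] .
  show ?thesis
    using coset_rep_add_left[of "a \<otimes> x" "a \<otimes> i"] i assms by (simp add: r_distr l_mult_closed)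
qed

lemma coset_rep_coset_rep:
  assumes "x \<in> carrier R"
  shows "coset_rep R I (coset_rep R I x) = coset_rep R I x"
  using coset_rep_mult_coset_rep[OF assms one_closed] assms by simp

text \<open>Once inner representatives are erased by \<open>cong\<close>, each axiom is the
  corresponding law of R under one outer \<open>coset_rep\<close>.\<close>

lemma left_module_left_quotient: "left_module R (left_quotient R I)"
proof -
  let ?N = "left_quotient R I"
  note cong = coset_rep_add_coset_rep coset_rep_mult_coset_rep
  \<comment> \<open>Carrier elements are fixed by \<open>coset_rep\<close>; the laws for zero and
    one need this, since their left sides are representatives.\<close>
  have N: "x \<in> carrier R" "coset_rep R I x = x" if "x \<in> carrier ?N" for x
    using that by (auto simp: coset_rep_coset_rep)
  have "abelian_group ?N"
  proof (rule abelian_groupI)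
    fix x y z assume xyz: "x \<in> carrier ?N" "y \<in> carrier ?N" "z \<in> carrier ?N"
    note c = N(1)[OF xyz(1)] N(1)[OF xyz(2)] N(1)[OF xyz(3)]
    show "x \<oplus>\<^bsub>?N\<^esub> y \<oplus>\<^bsub>?N\<^esub> z = x \<oplus>\<^bsub>?N\<^esub> (y \<oplus>\<^bsub>?N\<^esub> z)"
      using c by (simp add: cong a_assoc)
  next
    fix x y assume xy: "x \<in> carrier ?N" "y \<in> carrier ?N"
    note c = N(1)[OF xy(1)] N(1)[OF xy(2)]
    show "x \<oplus>\<^bsub>?N\<^esub> y \<in> carrier ?N" using c by simp
    show "x \<oplus>\<^bsub>?N\<^esub> y = y \<oplus>\<^bsub>?N\<^esub> x" using a_comm[OF c] by simp
  next
    fix x assume x: "x \<in> carrier ?N"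
    show "\<zero>\<^bsub>?N\<^esub> \<oplus>\<^bsub>?N\<^esub> x = x" using N[OF x] by (simp add: cong)
    show "\<exists>y\<in>carrier ?N. y \<oplus>\<^bsub>?N\<^esub> x = \<zero>\<^bsub>?N\<^esub>"
      using N(1)[OF x]
      by (intro bexI[of _ "coset_rep R I (\<ominus> x)"]) (simp_all add: cong l_neg)
  qed simp
  moreover have "left_module_axioms R ?N"
  proof (rule left_module_axioms.intro)
    show "\<one> \<odot>\<^bsub>?N\<^esub> x = x" if "x \<in> carrier ?N" for x
      using N[OF that] by simp
  next
    fix a x assume a: "a \<in> carrier R" and x: "x \<in> carrier ?N"
    note c = N(1)[OF x]
    show "a \<odot>\<^bsub>?N\<^esub> x \<in> carrier ?N" using a c by simp
    show "(a \<otimes> b) \<odot>\<^bsub>?N\<^esub> x = a \<odot>\<^bsub>?N\<^esub> (b \<odot>\<^bsub>?N\<^esub> x)" if "b \<in> carrier R" for b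
      using a c that by (simp add: cong m_assoc)
    show "(a \<oplus> b) \<odot>\<^bsub>?N\<^esub> x = a \<odot>\<^bsub>?N\<^esub> x \<oplus>\<^bsub>?N\<^esub> b \<odot>\<^bsub>?N\<^esub> x" if "b \<in> carrier R" for b
      using a c that by (simp add: cong l_distr)
    show "a \<odot>\<^bsub>?N\<^esub> (x \<oplus>\<^bsub>?N\<^esub> y) = a \<odot>\<^bsub>?N\<^esub> x \<oplus>\<^bsub>?N\<^esub> a \<odot>\<^bsub>?N\<^esub> y" if "y \<in> carrier ?N" for y
      using a c N(1)[OF that] by (simp add: cong r_distr)
  qed
  ultimately show ?thesis by (intro left_module.intro ring_axioms)
qed

end

lemma (in ring) left_ideal_principal:
  assumes r: "r \<in> carrier R"
  shows "left_ideal ((\<lambda>a. a \<otimes> r) ` carrier R) R"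
proof (intro left_ideal.intro ring_axioms additive_subgroup.intro left_ideal_axioms.intro
    add.subgroupI)
  fix x assume "x \<in> (\<lambda>a. a \<otimes> r) ` carrier R"
  then obtain a where a: "a \<in> carrier R" "x = a \<otimes> r" by auto
  show "\<ominus> x \<in> (\<lambda>a. a \<otimes> r) ` carrier R"
    using a r by (intro image_eqI[of _ _ "\<ominus> a"]) (simp_all add: l_minus)
  show "b \<otimes> x \<in> (\<lambda>a. a \<otimes> r) ` carrier R" if "b \<in> carrier R" for b
    using a r that by (intro image_eqI[of _ _ "b \<otimes> a"]) (simp_all add: m_assoc)
  fix y assume "y \<in> (\<lambda>a. a \<otimes> r) ` carrier R"
  then obtain b where b: "b \<in> carrier R" "y = b \<otimes> r" by auto
  show "x \<oplus> y \<in> (\<lambda>a. a \<otimes> r) ` carrier R"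
    using a b r by (intro image_eqI[of _ _ "a \<oplus> b"]) (simp_all add: l_distr)
qed (use r in auto)

section \<open>Vanishing tensors and evaluation in M\<close>

text \<open>Additivity in the second argument at 0 + 0 = 0 is the relation (x, 0) - (x, 0) - (x, 0),
  that is, the negative of the generator (x, 0).\<close>

lemma tensor_kernel_zero_right:
  assumes "right_module R M" "left_module R N" "x \<in> carrier M"
  shows "frag_of (x, \<zero>\<^bsub>N\<^esub>) \<in> tensor_kernel R M N"
proof -
  interpret N: left_module R N by fact
  have "- frag_of (x, \<zero>\<^bsub>N\<^esub>) \<in> tensor_kernel R M N"
    using tensor_kernel_incl[OF tensor_rels_intros(2)[OF assms(3), of "\<zero>\<^bsub>N\<^esub>" N "\<zero>\<^bsub>N\<^esub>" R]] by simp
  from tensor_kernel_minus[OF assms(1,2) this] show ?thesis by simp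
qed

lemma right_module_smult_minus:
  assumes "right_module R M" "a \<in> carrier R" "x \<in> carrier M"
  shows "a \<odot>\<^bsub>M\<^esub> (\<ominus>\<^bsub>M\<^esub> x) = \<ominus>\<^bsub>M\<^esub> (a \<odot>\<^bsub>M\<^esub> x)"
proof -
  interpret M: right_module R M by fact
  have "a \<odot>\<^bsub>M\<^esub> \<zero>\<^bsub>M\<^esub> = \<zero>\<^bsub>M\<^esub>"
    using M.smult_r_distr[of a "\<zero>\<^bsub>M\<^esub>" "\<zero>\<^bsub>M\<^esub>"] assms(2) M.smult_closed
    by (metis M.M.add.r_cancel_one' M.M.l_zero M.M.zero_closed)
  then show ?thesis
    using M.smult_r_distr[of a "\<ominus>\<^bsub>M\<^esub> x" x] assms M.smult_closed
    by (metis M.M.minus_equality M.M.a_inv_closed M.M.l_neg)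
qed

text \<open>Over a noncommutative ring the set Pr is in general an additive subgroup rather than a
  submodule. It serves below as the subgroup \<open>Q\<close>.\<close>

lemma subgroup_smult_image:
  assumes "right_module R M" "submodule P R M" "r \<in> carrier R"
  shows "subgroup ((\<lambda>x. r \<odot>\<^bsub>M\<^esub> x) ` P) (add_monoid M)"
proof -
  interpret M: right_module R M by fact
  interpret P: subgroup P "add_monoid M" using assms(2) by (simp add: submodule_def)
  have sub: "x \<in> carrier M" if "x \<in> P" for x using P.subset that by auto
  show ?thesis
  proof (rule M.M.add.subgroupI)
    fix u assume "u \<in> (\<lambda>x. r \<odot>\<^bsub>M\<^esub> x) ` P"
    then obtain x where x: "x \<in> P" "u = r \<odot>\<^bsub>M\<^esub> x" by auto
    show "\<ominus>\<^bsub>M\<^esub> u \<in> (\<lambda>x. r \<odot>\<^bsub>M\<^esub> x) ` P"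
      using x P.m_inv_closed[OF x(1)] right_module_smult_minus[OF assms(1,3) sub[OF x(1)]]
      by (intro image_eqI[of _ _ "\<ominus>\<^bsub>M\<^esub> x"]) (simp_all add: a_inv_def)
    fix v assume "v \<in> (\<lambda>x. r \<odot>\<^bsub>M\<^esub> x) ` P"
    then obtain y where y: "y \<in> P" "v = r \<odot>\<^bsub>M\<^esub> y" by auto
    show "u \<oplus>\<^bsub>M\<^esub> v \<in> (\<lambda>x. r \<odot>\<^bsub>M\<^esub> x) ` P"
      using x y P.m_closed[OF x(1) y(1)] assms(3)
      by (intro image_eqI[of _ _ "x \<oplus>\<^bsub>M\<^esub> y"]) (simp_all add: M.smult_r_distr sub)
  qed (use P.one_closed assms(3) in \<open>auto simp: sub M.smult_closed\<close>)
qed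

lemma (in abelian_group) add_minus_minus_cancel:
  assumes "v \<in> carrier G" "x \<in> carrier G" "y \<in> carrier G"
  shows "v \<oplus> (x \<oplus> y) \<ominus> x \<ominus> y = v"
proof -
  have "v \<oplus> (x \<oplus> y) \<ominus> x \<ominus> y = v \<oplus> ((x \<oplus> y) \<oplus> \<ominus> (x \<oplus> y))"
    using assms by (simp add: minus_eq minus_add a_assoc)
  also have "\<dots> = v" using assms by (simp add: r_neg del: minus_add)
  finally show ?thesis .
qed

text \<open>Evaluation (x, s) to x s extends to the free abelian group and sends every tensor
  relation into \<open>Q\<close>, because changing a representative costs an element of P I, hence
  of \<open>Q\<close>. So the kernel lands in \<open>Q\<close>, and evaluating at the class of 1
  returns p up to \<open>Q\<close>. Membership in \<open>Q\<close> replaces vanishing in M/Q, so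
  that quotient need not be formed.\<close>

lemma tensor_left_quotient_zero:
  assumes M: "right_module R M" and P: "submodule P R M" and p: "p \<in> P"
    and I: "left_ideal I R" and Q: "subgroup Q (add_monoid M)"
    and Q_I: "\<And>i x. i \<in> I \<Longrightarrow> x \<in> P \<Longrightarrow> i \<odot>\<^bsub>M\<^esub> x \<in> Q"
    and ker: "frag_of (p, coset_rep R I \<one>\<^bsub>R\<^esub>)
      \<in> tensor_kernel R (M\<lparr>carrier := P\<rparr>) (left_quotient R I)"
  shows "p \<in> Q"
proof -
  interpret M: right_module R M by fact
  interpret I: left_ideal I R by fact
  let ?N = "left_quotient R I" and ?P = "M\<lparr>carrier := P\<rparr>"
  let ?F = "free_Abelian_group (carrier ?P \<times> carrier ?N)"
  note mP = right_module_submodule[OF M P] and mN = I.left_module_left_quotient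
  note sub = subsetD[OF submodule_subset[OF P]]
  note sP = submodule_smult[OF P]
  have QM: "u \<in> carrier M" if "u \<in> Q" for u using subgroup.subset[OF Q] that by auto
  have Q_zero: "\<zero>\<^bsub>M\<^esub> \<in> Q"
    using subgroup.one_closed[OF Q] by simp
  have Q_minus: "\<ominus>\<^bsub>M\<^esub> u \<in> Q" if "u \<in> Q" for u
    using subgroup.m_inv_closed[OF Q that] by (simp add: a_inv_def)
  have Q_add: "u \<oplus>\<^bsub>M\<^esub> v \<in> Q" if "u \<in> Q" "v \<in> Q" for u v
    using subgroup.m_closed[OF Q that] by simp
  \<comment> \<open>If the representative of s is i + s, the error term u is x i.\<close>
  have rep: "\<exists>u \<in> Q. coset_rep R I s \<odot>\<^bsub>M\<^esub> x = u \<oplus>\<^bsub>M\<^esub> s \<odot>\<^bsub>M\<^esub> x"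
    if sx: "s \<in> carrier R" "x \<in> P" for s x
  proof -
    obtain i where i: "i \<in> I" "coset_rep R I s = i \<oplus>\<^bsub>R\<^esub> s"
      using I.coset_rep_eq_add[OF sx(1)] .
    then show ?thesis
      using sx by (intro bexI[OF _ Q_I[OF i(1) sx(2)]]) (simp add: M.smult_l_distr sub)
  qed
  have cN: "s \<in> carrier R" if "s \<in> carrier ?N" for s using that by auto
  have cG: "comm_group (add_monoid M)" by (rule M.M.a_comm_group)
  have "(\<lambda>(x, s). s \<odot>\<^bsub>M\<^esub> x) ` (carrier ?P \<times> carrier ?N) \<subseteq> carrier (add_monoid M)"
    by (auto simp: sub M.smult_closed)
  then obtain h where h: "h \<in> hom ?F (add_monoid M)"
    and h_of: "\<And>w. w \<in> carrier ?P \<times> carrier ?N \<Longrightarrow> h (frag_of w) = (\<lambda>(x, s). s \<odot>\<^bsub>M\<^esub> x) w"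
    using comm_group.free_Abelian_group_universal[OF cG] by metis
  interpret h: group_hom ?F "add_monoid M" h
    by (intro group_hom.intro group_hom_axioms.intro group_free_Abelian_group M.M.a_group h)
  have h_of': "h (frag_of (x, s)) = s \<odot>\<^bsub>M\<^esub> x" if "x \<in> P" "s \<in> carrier ?N" for x s
    using h_of[of "(x, s)"] that by simp
  have h_add: "h (a + b) = h a \<oplus>\<^bsub>M\<^esub> h b" if "a \<in> carrier ?F" "b \<in> carrier ?F" for a b
    using h.hom_mult[OF that] by simp
  have h_minus: "h (- a) = \<ominus>\<^bsub>M\<^esub> h a" if "a \<in> carrier ?F" for a
    using h.hom_inv[OF that] that by (simp add: a_inv_def)
  have F_minus: "- a \<in> carrier ?F" if "a \<in> carrier ?F" for a
    using that by simp
  have h_diff: "h (a - b) = h a \<ominus>\<^bsub>M\<^esub> h b" if "a \<in> carrier ?F" "b \<in> carrier ?F" for a b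
    using h_add[OF that(1) F_minus[OF that(2)]] h_minus[OF that(2)] by (simp add: a_minus_def)
  have F_of: "frag_of (x, s) \<in> carrier ?F" if "x \<in> P" "s \<in> carrier ?N" for x s
    using that by (simp add: keys_frag_of)
  have F_diff: "a - b \<in> carrier ?F" if "a \<in> carrier ?F" "b \<in> carrier ?F" for a b
    using that by (simp add: keys_diff_subset)
  have h_diff_of: "h (frag_of (x, s) - frag_of (y, t)) = s \<odot>\<^bsub>M\<^esub> x \<ominus>\<^bsub>M\<^esub> t \<odot>\<^bsub>M\<^esub> y"
    if "x \<in> P" "s \<in> carrier ?N" "y \<in> P" "t \<in> carrier ?N" for x y s t
    unfolding h_diff[OF F_of[OF that(1,2)] F_of[OF that(3,4)]]
      h_of'[OF that(1,2)] h_of'[OF that(3,4)] ..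
  have h_diff_diff_of: "h (frag_of (x, s) - frag_of (y, t) - frag_of (z, w)) =
      (s \<odot>\<^bsub>M\<^esub> x \<ominus>\<^bsub>M\<^esub> t \<odot>\<^bsub>M\<^esub> y) \<ominus>\<^bsub>M\<^esub> w \<odot>\<^bsub>M\<^esub> z"
    if "x \<in> P" "s \<in> carrier ?N" "y \<in> P" "t \<in> carrier ?N" "z \<in> P" "w \<in> carrier ?N"
    for x y z s t w
    unfolding h_diff[OF F_diff[OF F_of[OF that(1,2)] F_of[OF that(3,4)]] F_of[OF that(5,6)]]
      h_diff_of[OF that(1-4)] h_of'[OF that(5,6)] ..
  have rels: "h u \<in> Q" if "u \<in> tensor_rels R ?P ?N" for u
    using that
  proof (cases rule: tensor_rels_cases)
    case (add_left x x' s)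
    then have c: "x \<in> P" "x' \<in> P" "x \<oplus>\<^bsub>M\<^esub> x' \<in> P" "s \<in> carrier ?N" "s \<in> carrier R"
      using submodule_add[OF P] cN by auto
    \<comment> \<open>No sum in the quotient occurs here, so the value cancels exactly.\<close>
    have "h u = (s \<odot>\<^bsub>M\<^esub> (x \<oplus>\<^bsub>M\<^esub> x') \<ominus>\<^bsub>M\<^esub> s \<odot>\<^bsub>M\<^esub> x) \<ominus>\<^bsub>M\<^esub> s \<odot>\<^bsub>M\<^esub> x'"
      unfolding add_left(4) using h_diff_diff_of[OF c(3,4,1,4,2,4)] by simp
    also have "\<dots> = \<zero>\<^bsub>M\<^esub>"
      using c by (simp add: M.smult_r_distr sub M.smult_closed M.M.minus_eq M.M.a_ac
          M.M.r_neg M.M.r_neg1 M.M.r_neg2)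
    finally show ?thesis using Q_zero by simp
  next
    case (add_right x s t)
    then have c: "x \<in> P" "s \<in> carrier ?N" "t \<in> carrier ?N" "s \<oplus>\<^bsub>?N\<^esub> t \<in> carrier ?N"
      "s \<in> carrier R" "t \<in> carrier R"
      using cN by auto
    obtain v where v: "v \<in> Q" "coset_rep R I (s \<oplus>\<^bsub>R\<^esub> t) \<odot>\<^bsub>M\<^esub> x = v \<oplus>\<^bsub>M\<^esub> (s \<oplus>\<^bsub>R\<^esub> t) \<odot>\<^bsub>M\<^esub> x"
      using rep[of "s \<oplus>\<^bsub>R\<^esub> t" x] c by auto
    \<comment> \<open>Addition in the quotient replaces s + t by its representative; what survives
      is the error v.\<close>
    have "h u = (coset_rep R I (s \<oplus>\<^bsub>R\<^esub> t) \<odot>\<^bsub>M\<^esub> x \<ominus>\<^bsub>M\<^esub> s \<odot>\<^bsub>M\<^esub> x) \<ominus>\<^bsub>M\<^esub> t \<odot>\<^bsub>M\<^esub> x"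
      unfolding add_right(4) using h_diff_diff_of[OF c(1,4,1,2,1,3)] by simp
    also have "\<dots> = v"
      using c QM[OF v(1)] unfolding v(2)
      by (simp add: M.smult_l_distr sub M.smult_closed M.M.add_minus_minus_cancel
          del: left_quotient_simps)
    finally show ?thesis using v by simp
  next
    case (balance a x s)
    then have c: "x \<in> P" "a \<odot>\<^bsub>M\<^esub> x \<in> P" "s \<in> carrier ?N" "a \<odot>\<^bsub>?N\<^esub> s \<in> carrier ?N"
      "s \<in> carrier R" "a \<in> carrier R"
      using cN sP by auto
    obtain v where v: "v \<in> Q" "coset_rep R I (a \<otimes>\<^bsub>R\<^esub> s) \<odot>\<^bsub>M\<^esub> x = v \<oplus>\<^bsub>M\<^esub> (a \<otimes>\<^bsub>R\<^esub> s) \<odot>\<^bsub>M\<^esub> x"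
      using rep[of "a \<otimes>\<^bsub>R\<^esub> s" x] c by auto
    \<comment> \<open>Since (x a) s = x (a s), only the error v is left, with a minus sign because
      the representative occurs in the subtracted tensor.\<close>
    have "h u = s \<odot>\<^bsub>M\<^esub> (a \<odot>\<^bsub>M\<^esub> x) \<ominus>\<^bsub>M\<^esub> coset_rep R I (a \<otimes>\<^bsub>R\<^esub> s) \<odot>\<^bsub>M\<^esub> x"
      unfolding balance(4) using h_diff_of[OF c(2,3,1,4)] by simp
    also have "\<dots> = \<ominus>\<^bsub>M\<^esub> v"
      using c QM[OF v(1)] unfolding v(2)
      by (simp add: M.smult_assoc sub M.smult_closed M.M.minus_eq M.M.minus_add M.M.a_ac
          M.M.r_neg M.M.r_neg1 M.M.r_neg2)
    finally show ?thesis using Q_minus[OF v(1)] by simp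
  qed
  have F_rels: "u \<in> carrier ?F" if "u \<in> tensor_rels R ?P ?N" for u
    using tensor_rels_carrier[OF mP mN] that by blast
  \<comment> \<open>Carrier membership is carried along because h is additive only on
    \<open>?F\<close>.\<close>
  have "z \<in> carrier ?F \<and> h z \<in> Q" if "z \<in> tensor_kernel R ?P ?N" for z
    using that mP mN
  proof (induction rule: tensor_kernel_induct)
    case zero
    show ?case using h.hom_one Q_zero by simp
  next
    case (rel u)
    then show ?case using rels F_rels by blast
  next
    case (minus_rel u)
    then show ?case using Q_minus[OF rels] F_minus[OF F_rels] h_minus[OF F_rels] by simp
  next
    case (add a b)
    then show ?case
      using h_add[of a b] Q_add[of "h a" "h b"] h.G.m_closed[of a b] by simp
  qed
  from this[OF ker] have "coset_rep R I \<one>\<^bsub>R\<^esub> \<odot>\<^bsub>M\<^esub> p \<in> Q"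
    using h_of'[of p "coset_rep R I \<one>\<^bsub>R\<^esub>"] p by simp
  \<comment> \<open>The representative of 1 need not be 1 itself, so p is recovered by subtracting
    the error v.\<close>
  moreover obtain v where v: "v \<in> Q" "coset_rep R I \<one>\<^bsub>R\<^esub> \<odot>\<^bsub>M\<^esub> p = v \<oplus>\<^bsub>M\<^esub> p"
    using rep[of "\<one>\<^bsub>R\<^esub>" p] p by (auto simp: M.smult_one sub)
  ultimately have "\<ominus>\<^bsub>M\<^esub> v \<oplus>\<^bsub>M\<^esub> (v \<oplus>\<^bsub>M\<^esub> p) \<in> Q"
    using Q_add Q_minus by simp
  then show ?thesis using QM[OF v(1)] sub[OF p] by (simp add: M.M.r_neg1)
qed

section \<open>From purity to relative divisibility\<close>

text \<open>The substance is that Mr meets P inside Pr; the reverse inclusion is closure of P under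
  scalars.\<close>

lemma pure_imp_rd_pure:
  fixes R :: "('r, 'x) ring_scheme" and M :: "('r, 'm, 'y) module_scheme"
  assumes M: "right_module R M" and pure: "pure_submodule R M P"
  shows "rd_pure_submodule R M P"
proof -
  interpret M: right_module R M by fact
  have P: "submodule P R M" using pure by (simp add: pure_submodule_def)
  have "r \<odot>\<^bsub>M\<^esub> m \<in> (\<lambda>x. r \<odot>\<^bsub>M\<^esub> x) ` P"
    if r: "r \<in> carrier R" and m: "m \<in> carrier M" and rm: "r \<odot>\<^bsub>M\<^esub> m \<in> P" for r m
  proof -
    define I where "I = (\<lambda>a. a \<otimes>\<^bsub>R\<^esub> r) ` carrier R"
    interpret I: left_ideal I R unfolding I_def by (rule M.R.left_ideal_principal[OF r])
    let ?N = "left_quotient R I" and ?e = "coset_rep R I \<one>\<^bsub>R\<^esub>"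
    note N = I.left_module_left_quotient
    have "r \<in> I" unfolding I_def using r by (intro image_eqI[of _ _ "\<one>\<^bsub>R\<^esub>"]) simp_all
    \<comment> \<open>As r lies in I = Rr, the product r e is the representative of r = r + 0, hence
      that of 0.\<close>
    then have re: "r \<odot>\<^bsub>?N\<^esub> ?e = \<zero>\<^bsub>?N\<^esub>"
      using I.coset_rep_mult_coset_rep[of "\<one>\<^bsub>R\<^esub>" r] I.coset_rep_add_left[of "\<zero>\<^bsub>R\<^esub>" r] r by simp
    \<comment> \<open>The balance relation moves r across the tensor sign, and r e = 0.\<close>
    have "frag_of (r \<odot>\<^bsub>M\<^esub> m, ?e) - frag_of (m, \<zero>\<^bsub>?N\<^esub>) \<in> tensor_kernel R M ?N"
      using tensor_kernel_incl[OF tensor_rels_intros(3)[OF r m, of ?e ?N]] unfolding re by simp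
    from tensor_kernel_add[OF this tensor_kernel_zero_right[OF M N m]]
    have "frag_of (r \<odot>\<^bsub>M\<^esub> m, ?e) \<in> tensor_kernel R M ?N" by simp
    moreover have "Poly_Mapping.keys (frag_of (r \<odot>\<^bsub>M\<^esub> m, ?e)) \<subseteq> P \<times> carrier ?N"
      using rm by (simp add: keys_frag_of)
    \<comment> \<open>Purity enters here. The carrier of \<open>?N\<close> lies in
      \<open>'r\<close>, while purity is defined by test modules on \<open>'r list\<close>;
      \<open>pure_submodule_injective\<close> bridges the types.\<close>
    ultimately have "frag_of (r \<odot>\<^bsub>M\<^esub> m, ?e) \<in> tensor_kernel R (M\<lparr>carrier := P\<rparr>) ?N"
      using pure_submodule_injective[OF M pure N] tensor_incl_inj_iff[OF M N P] by blast
    then show ?thesis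
    proof (rule tensor_left_quotient_zero[OF M P rm I.left_ideal_axioms
          subgroup_smult_image[OF M P r], rotated])
      fix i x assume "i \<in> I" "x \<in> P"
      then obtain a where "a \<in> carrier R" "i = a \<otimes>\<^bsub>R\<^esub> r" by (auto simp: I_def)
      \<comment> \<open>For i = a r, associativity gives x i = (x a) r, and x a is again in
        P.\<close>
      then show "i \<odot>\<^bsub>M\<^esub> x \<in> (\<lambda>x. r \<odot>\<^bsub>M\<^esub> x) ` P"
        using \<open>x \<in> P\<close> r submodule_smult[OF P] subsetD[OF submodule_subset[OF P]]
        by (intro image_eqI[of _ _ "a \<odot>\<^bsub>M\<^esub> x"]) (simp_all add: M.smult_assoc)
    qed
  qed
  then show ?thesis
    using P submodule_subset[OF P] submodule_smult[OF P] unfolding rd_pure_submodule_def by blast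
qed

text \<open>Pure submodules are among the RD-pure ones, so the summand supplied for an RD-pure
  submodule serves for a pure one.\<close>

theorem lemma21:
  fixes R :: "('r, 'x) ring_scheme" and M :: "('r, 'm, 'y) module_scheme"
  assumes "right_module R M" and "rd_pure_extending R M"
  shows "pure_extending R M"
  using assms(2) pure_imp_rd_pure[OF assms(1)] by (simp add: pure_extending_def rd_pure_extending_def)

end
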